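(* Let $E$ and $F$ be proper BSFs on some set $X$ with $E\subset F$. If there exists an RKHS $H$ over $X$ with $E\subset H\subset F$, then the inclusion map $\mathrm{id}:E\to F$ is of both type 2 and cotype 2.
   Context: Let $X\neq\emptyset$ be a set. A Banach space of functions (BSF) on $X$ is a Banach space whose elements are functions $X\to\mathbb{R}$. A BSF $E$ on $X$ is proper if for every $x\in X$ the evaluation functional $\delta_x:E\to\mathbb{R}$, $f\mapsto f(x)$, is continuous. A reproducing kernel Hilbert space (RKHS) on (over) $X$ is a proper BSF on $X$ whose norm is a Hilbert space norm. Inclusions $E\subset H\subset F$ are inclusions of sets of functions. Let $(\varepsilon_i)$ be a Rademacher sequence, i.e. i.i.d. random variables with $\mathbb{P}(\varepsilon_1=1)=\mathbb{P}(\varepsilon_1=-1)=1/2$. A bounded linear operator $A:E\to F$ between Banach spaces is of type 2 if there is $C\ge0$ with $\mathbb{E}\|\sum_{i=1}^n\varepsilon_iAx_i\|_F\le C\bigl(\sum_{i=1}^n\|x_i\|_E^2\bigr)^{1/2}$ for all $n\in\mathbb{N}$ and $x_1,\dots,x_n\in E$; it is of cotype 2 if there is $C\ge0$ with $\bigl(\sum_{i=1}^n\|Ax_i\|_F^2\bigr)^{1/2}\le C\,\mathbb{E}\|\sum_{i=1}^n\varepsilon_ix_i\|_E$ for all such $n$ and $x_i$. *)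

theory Defs
  imports "HOL-Probability.Probability" "HOL-Library.Function_Algebras"
begin

instantiation "fun" :: (type, real_vector) real_vector
begin

definition scaleR_fun :: "real \<Rightarrow> ('a \<Rightarrow> 'b) \<Rightarrow> 'a \<Rightarrow> 'b"
  where "scaleR_fun c f = (\<lambda>x. c *\<^sub>R f x)"

instance
  by standard (simp_all add: scaleR_fun_def fun_eq_iff scaleR_add_right scaleR_add_left)

end

text \<open>
  A normed space is given by a linear subspace \<open>V\<close> of an ambient real vector space together with
  a norm \<open>N\<close>, whose values outside \<open>V\<close> are irrelevant.
\<close>

definition norm_on :: "'a::real_vector set \<Rightarrow> ('a \<Rightarrow> real) \<Rightarrow> bool" where
  "norm_on V N \<longleftrightarrow>
     (\<forall>v\<in>V. 0 \<le> N v) \<and>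
     (\<forall>v\<in>V. N v = 0 \<longrightarrow> v = 0) \<and>
     (\<forall>c. \<forall>v\<in>V. N (c *\<^sub>R v) = \<bar>c\<bar> * N v) \<and>
     (\<forall>v\<in>V. \<forall>w\<in>V. N (v + w) \<le> N v + N w)"

definition complete_norm_on :: "'a::real_vector set \<Rightarrow> ('a \<Rightarrow> real) \<Rightarrow> bool" where
  "complete_norm_on V N \<longleftrightarrow>
     (\<forall>s::nat \<Rightarrow> 'a. (\<forall>n. s n \<in> V) \<and>
        (\<forall>e>0. \<exists>K. \<forall>m\<ge>K. \<forall>n\<ge>K. N (s m - s n) < e) \<longrightarrow>
        (\<exists>l\<in>V. (\<lambda>n. N (s n - l)) \<longlonglongrightarrow> 0))"

definition banach_space_on :: "'a::real_vector set \<Rightarrow> ('a \<Rightarrow> real) \<Rightarrow> bool" where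
  "banach_space_on V N \<longleftrightarrow> subspace V \<and> norm_on V N \<and> complete_norm_on V N"

definition continuous_functional_on ::
    "'a::real_vector set \<Rightarrow> ('a \<Rightarrow> real) \<Rightarrow> ('a \<Rightarrow> real) \<Rightarrow> bool" where
  "continuous_functional_on V N \<phi> \<longleftrightarrow>
     (\<forall>v\<in>V. \<forall>e>0. \<exists>d>0. \<forall>w\<in>V. N (w - v) < d \<longrightarrow> \<bar>\<phi> w - \<phi> v\<bar> < e)"

text \<open>
  The underlying nonempty set of points is the type \<open>'x\<close>; the vector space operations on
  \<open>'x \<Rightarrow> real\<close> are pointwise.
\<close>

definition bsf :: "('x \<Rightarrow> real) set \<Rightarrow> (('x \<Rightarrow> real) \<Rightarrow> real) \<Rightarrow> bool" where
  "bsf E N \<longleftrightarrow> banach_space_on E N"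

definition proper_bsf :: "('x \<Rightarrow> real) set \<Rightarrow> (('x \<Rightarrow> real) \<Rightarrow> real) \<Rightarrow> bool" where
  "proper_bsf E N \<longleftrightarrow> bsf E N \<and> (\<forall>x. continuous_functional_on E N (\<lambda>f. f x))"

definition inner_product_on :: "'a::real_vector set \<Rightarrow> ('a \<Rightarrow> 'a \<Rightarrow> real) \<Rightarrow> bool" where
  "inner_product_on V ip \<longleftrightarrow>
     (\<forall>v\<in>V. \<forall>w\<in>V. ip v w = ip w v) \<and>
     (\<forall>u\<in>V. \<forall>v\<in>V. \<forall>w\<in>V. ip (u + v) w = ip u w + ip v w) \<and>
     (\<forall>c. \<forall>v\<in>V. \<forall>w\<in>V. ip (c *\<^sub>R v) w = c * ip v w) \<and>
     (\<forall>v\<in>V. 0 \<le> ip v v) \<and>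
     (\<forall>v\<in>V. ip v v = 0 \<longrightarrow> v = 0)"

definition hilbert_norm_on :: "'a::real_vector set \<Rightarrow> ('a \<Rightarrow> real) \<Rightarrow> bool" where
  "hilbert_norm_on V N \<longleftrightarrow>
     (\<exists>ip. inner_product_on V ip \<and> (\<forall>v\<in>V. N v = sqrt (ip v v)))"

definition rkhs :: "('x \<Rightarrow> real) set \<Rightarrow> (('x \<Rightarrow> real) \<Rightarrow> real) \<Rightarrow> bool" where
  "rkhs H N \<longleftrightarrow> proper_bsf H N \<and> hilbert_norm_on H N"

locale rademacher_sequence = prob_space M for M :: "'w measure" +
  fixes \<epsilon> :: "nat \<Rightarrow> 'w \<Rightarrow> real"
  assumes indep: "indep_vars (\<lambda>_. borel) \<epsilon> UNIV"
    and prob_1: "prob {\<omega> \<in> space M. \<epsilon> i \<omega> = 1} = 1 / 2"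
    and prob_minus_1: "prob {\<omega> \<in> space M. \<epsilon> i \<omega> = -1} = 1 / 2"

definition bounded_linear_operator_on ::
    "'a::real_vector set \<Rightarrow> ('a \<Rightarrow> real) \<Rightarrow> 'b::real_vector set \<Rightarrow> ('b \<Rightarrow> real) \<Rightarrow> ('a \<Rightarrow> 'b) \<Rightarrow> bool" where
  "bounded_linear_operator_on E NE F NF A \<longleftrightarrow>
     (\<forall>x\<in>E. A x \<in> F) \<and>
     (\<forall>x\<in>E. \<forall>y\<in>E. A (x + y) = A x + A y) \<and>
     (\<forall>c. \<forall>x\<in>E. A (c *\<^sub>R x) = c *\<^sub>R A x) \<and>
     (\<exists>C\<ge>0. \<forall>x\<in>E. NF (A x) \<le> C * NE x)"

definition type_2 ::
    "'w measure \<Rightarrow> (nat \<Rightarrow> 'w \<Rightarrow> real) \<Rightarrow> 'a::real_vector set \<Rightarrow> ('a \<Rightarrow> real) \<Rightarrow>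
     'b::real_vector set \<Rightarrow> ('b \<Rightarrow> real) \<Rightarrow> ('a \<Rightarrow> 'b) \<Rightarrow> bool" where
  "type_2 M \<epsilon> E NE F NF A \<longleftrightarrow>
     bounded_linear_operator_on E NE F NF A \<and>
     (\<exists>C\<ge>0. \<forall>n. \<forall>x::nat \<Rightarrow> 'a. (\<forall>i<n. x i \<in> E) \<longrightarrow>
        (\<integral>\<omega>. NF (\<Sum>i<n. \<epsilon> i \<omega> *\<^sub>R A (x i)) \<partial>M) \<le> C * sqrt (\<Sum>i<n. (NE (x i))\<^sup>2))"

definition cotype_2 ::
    "'w measure \<Rightarrow> (nat \<Rightarrow> 'w \<Rightarrow> real) \<Rightarrow> 'a::real_vector set \<Rightarrow> ('a \<Rightarrow> real) \<Rightarrow>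
     'b::real_vector set \<Rightarrow> ('b \<Rightarrow> real) \<Rightarrow> ('a \<Rightarrow> 'b) \<Rightarrow> bool" where
  "cotype_2 M \<epsilon> E NE F NF A \<longleftrightarrow>
     bounded_linear_operator_on E NE F NF A \<and>
     (\<exists>C\<ge>0. \<forall>n. \<forall>x::nat \<Rightarrow> 'a. (\<forall>i<n. x i \<in> E) \<longrightarrow>
        sqrt (\<Sum>i<n. (NF (A (x i)))\<^sup>2) \<le> C * (\<integral>\<omega>. NE (\<Sum>i<n. \<epsilon> i \<omega> *\<^sub>R x i) \<partial>M))"

end

theory Submission
  imports Defs
begin

text \<open>
  An inclusion \<open>E \<subseteq> F\<close> with an RKHS \<open>H\<close> in between factors through a Hilbert space. Both inclusions
  \<open>E \<subseteq> H\<close> and \<open>H \<subseteq> F\<close> are automatically bounded (\<open>proper_bsf_inclusion_bounded\<close>): since evaluations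
  are continuous in all three spaces, limits are pointwise limits, so the inclusions have closed
  graphs. It therefore suffices that Hilbert spaces have type 2 and cotype 2, as a Rademacher
  average in \<open>E\<close> or \<open>F\<close> is compared with the one in \<open>H\<close> at the cost of a constant.

  For Hilbert spaces, orthogonality of the Rademacher variables gives that the second moment of
  the norm of a Rademacher sum is exactly the sum of the squared norms of the vectors. Type 2
  follows by Jensen's inequality. Cotype 2 needs the reverse comparison of the first moment with
  the second one. It follows from the bound of the fourth moment by three times the square of the
  second (\<open>sign_mean_inner_fourth_power\<close>) and an elementary interpolation
  (\<open>sign_mean_power_interpolation\<close>).

  The integrals depend only on the distribution of finitely many signs, which is uniform; so all
  estimates are made for finite averages over sign choices (\<open>sign_mean\<close>), and
  \<open>expectation_norm_eq_sign_mean\<close> transfers them to an arbitrary Rademacher sequence.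
\<close>

section \<open>Norms on subspaces\<close>

lemma norm_onD:
  assumes "norm_on V N" "v \<in> V"
  shows "0 \<le> N v" and "N v = 0 \<Longrightarrow> v = 0" and "N (c *\<^sub>R v) = \<bar>c\<bar> * N v"
    and "w \<in> V \<Longrightarrow> N (v + w) \<le> N v + N w"
  using assms unfolding norm_on_def by simp_all

lemma norm_on_subset: "norm_on W N \<Longrightarrow> V \<subseteq> W \<Longrightarrow> norm_on V N"
  by (simp add: norm_on_def subset_iff)

lemma norm_on_minus: "norm_on V N \<Longrightarrow> v \<in> V \<Longrightarrow> N (- v) = N v"
  using norm_onD(3)[of V N v "-1"] by simp

lemma norm_on_zero: "norm_on V N \<Longrightarrow> subspace V \<Longrightarrow> N 0 = 0"
  using norm_onD(3)[of V N 0 0] subspace_0[of V] by simp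

lemma norm_on_diff_commute:
  "norm_on V N \<Longrightarrow> subspace V \<Longrightarrow> v \<in> V \<Longrightarrow> w \<in> V \<Longrightarrow> N (v - w) = N (w - v)"
  using norm_on_minus[of V N "v - w"] subspace_diff[of V v w] by simp

lemma norm_on_diff_triangle:
  assumes "norm_on V N" "subspace V" "u \<in> V" "v \<in> V" "w \<in> V"
  shows "N (u - w) \<le> N (u - v) + N (v - w)"
  using norm_onD(4)[of V N "u - v" "v - w"] assms by (simp add: subspace_diff)

lemma norm_on_diff_le:
  assumes "norm_on V N" "subspace V" "v \<in> V" "w \<in> V"
  shows "N (v - w) \<le> N v + N w"
  using norm_on_diff_triangle[OF assms(1,2), of v 0 w] norm_on_minus[OF assms(1,4)] assms
  by (simp add: subspace_0)

lemma norm_on_sum_le: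
  assumes "norm_on V N" "subspace V" "finite I" "\<And>i. i \<in> I \<Longrightarrow> f i \<in> V"
  shows "N (\<Sum>i\<in>I. f i) \<le> (\<Sum>i\<in>I. N (f i))"
  using assms(3,4)
proof (induction I rule: finite_induct)
  case empty
  then show ?case using norm_on_zero[OF assms(1,2)] by simp
next
  case (insert i I)
  have "(\<Sum>j\<in>I. f j) \<in> V" using insert by (intro subspace_sum[OF assms(2)]) auto
  then have "N (f i + (\<Sum>j\<in>I. f j)) \<le> N (f i) + N (\<Sum>j\<in>I. f j)"
    using insert by (intro norm_onD(4)[OF assms(1)]) auto
  then show ?case using insert by auto
qed

section \<open>Boundedness of inclusions between proper spaces of functions\<close>

text \<open>
  The theory of metric spaces on a carrier asks for nonnegativity and symmetry on the whole type,
  whereas \<open>norm_on\<close> leaves the values outside the subspace arbitrary; hence the default value 0.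
\<close>

definition norm_distance :: "'a::real_vector set \<Rightarrow> ('a \<Rightarrow> real) \<Rightarrow> 'a \<Rightarrow> 'a \<Rightarrow> real" where
  "norm_distance V N v w = (if v \<in> V \<and> w \<in> V then N (v - w) else 0)"

lemma Metric_space_norm_distance:
  assumes "norm_on V N" "subspace V"
  shows "Metric_space V (norm_distance V N)"
proof
  fix v w u
  show "0 \<le> norm_distance V N v w"
    by (simp add: norm_distance_def norm_onD(1)[OF assms(1)] subspace_diff[OF assms(2)])
  show "norm_distance V N v w = norm_distance V N w v"
    by (simp add: norm_distance_def norm_on_diff_commute[OF assms])
  show "norm_distance V N v w = 0 \<longleftrightarrow> v = w" if "v \<in> V" "w \<in> V"
    using that norm_onD(2)[OF assms(1) subspace_diff[OF assms(2) that]] norm_on_zero[OF assms]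
    by (auto simp: norm_distance_def)
  show "norm_distance V N v u \<le> norm_distance V N v w + norm_distance V N w u"
    if "v \<in> V" "w \<in> V" "u \<in> V"
    using that norm_on_diff_triangle[OF assms] by (simp add: norm_distance_def)
qed

lemma mcomplete_norm_distance:
  assumes "banach_space_on V N"
  shows "Metric_space.mcomplete V (norm_distance V N)"
proof -
  have sub: "subspace V" and nrm: "norm_on V N" and compl: "complete_norm_on V N"
    using assms by (auto simp: banach_space_on_def)
  interpret Metric_space V "norm_distance V N"
    by (rule Metric_space_norm_distance[OF nrm sub])
  show ?thesis
    unfolding mcomplete_def
  proof (intro allI impI)
    fix s assume s: "MCauchy s"
    then have sV: "s n \<in> V" for n unfolding MCauchy_def by auto
    have "\<exists>K. \<forall>m\<ge>K. \<forall>n\<ge>K. N (s m - s n) < e" if "e > 0" for e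
    proof -
      obtain K where "\<And>m n. K \<le> m \<Longrightarrow> K \<le> n \<Longrightarrow> norm_distance V N (s m) (s n) < e"
        using s \<open>e > 0\<close> unfolding MCauchy_def by meson
      then show ?thesis using sV unfolding norm_distance_def by auto
    qed
    with compl sV obtain l where l: "l \<in> V" "(\<lambda>n. N (s n - l)) \<longlonglongrightarrow> 0"
      unfolding complete_norm_on_def by blast
    have "limitin mtopology s l sequentially"
      unfolding limit_metric_sequentially
    proof (intro conjI allI impI)
      fix e :: real assume "e > 0"
      with l(2) have "\<forall>\<^sub>F n in sequentially. N (s n - l) < e"
        by (rule order_tendstoD(2))
      then show "\<exists>K. \<forall>n\<ge>K. s n \<in> V \<and> norm_distance V N (s n) l < e"
        unfolding eventually_sequentially using sV l(1) by (auto simp: norm_distance_def)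
    qed fact
    then show "\<exists>l. limitin mtopology s l sequentially" by blast
  qed
qed

text \<open>
  This is where completeness of the domain enters. The closed sets \<open>closure {y. q y \<le> n}\<close> cover the
  space, so by Baire's theorem one of them contains a ball around some \<open>x0\<close>. Sublevel sets of a
  norm are symmetric and convex, and so \<open>x = ((x0 + x) - (x0 - x)) / 2\<close> moves the ball to the origin.
\<close>

lemma sublevel_dense_in_ball:
  assumes E: "banach_space_on E N" and q: "norm_on E q"
  obtains K r where "0 \<le> K" "0 < r"
    "\<And>x e. x \<in> E \<Longrightarrow> N x < r \<Longrightarrow> 0 < e \<Longrightarrow> \<exists>y\<in>E. q y \<le> K \<and> N (x - y) < e"
proof -
  have sub: "subspace E" and nrm: "norm_on E N" using E by (auto simp: banach_space_on_def)
  interpret Metric_space E "norm_distance E N"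
    by (rule Metric_space_norm_distance[OF nrm sub])
  define B where "B n = mtopology closure_of {y \<in> E. q y \<le> real n}" for n
  have "(\<Union>n. B n) = E"
  proof
    show "(\<Union>n. B n) \<subseteq> E" unfolding B_def using closure_of_subset_topspace by fastforce
    show "E \<subseteq> (\<Union>n. B n)"
    proof
      fix x assume x: "x \<in> E"
      obtain n where "q x \<le> real n" using real_arch_simple by blast
      then have "x \<in> {y \<in> E. q y \<le> real n}" using x by simp
      then have "x \<in> B n" unfolding B_def
        using closure_of_subset[of "{y \<in> E. q y \<le> real n}" mtopology] by auto
      then show "x \<in> (\<Union>n. B n)" by blast
    qed
  qed
  moreover have "mtopology interior_of E \<noteq> {}"
    using interior_of_topspace[of mtopology] subspace_0[OF sub] by auto
  ultimately have nonempty: "mtopology interior_of \<Union>(range B) \<noteq> {}" by simp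
  have "\<not> (\<forall>T\<in>range B. closedin mtopology T \<and> mtopology interior_of T = {})"
  proof
    assume meagre: "\<forall>T\<in>range B. closedin mtopology T \<and> mtopology interior_of T = {}"
    have "mtopology interior_of \<Union>(range B) = {}"
      by (rule metric_Baire_category_alt[OF mcomplete_norm_distance[OF E]])
        (simp_all add: meagre[rule_format])
    with nonempty show False by simp
  qed
  then have "\<exists>n. mtopology interior_of (B n) \<noteq> {}"
    by (simp add: B_def)
  then obtain n x0 where "x0 \<in> mtopology interior_of (B n)" by blast
  then obtain r where x0: "x0 \<in> E" and r: "r > 0" and ball: "mball x0 r \<subseteq> B n"
    unfolding in_interior_of_mball by blast
  have approx: "\<exists>y\<in>E. q y \<le> real n \<and> N (x - y) < e"
    if "x \<in> E" "N (x - x0) < r" "e > 0" for x e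
  proof -
    have "x \<in> mball x0 r"
      using that x0 norm_on_diff_commute[OF nrm sub] by (simp add: norm_distance_def)
    then have "x \<in> B n" using ball by blast
    then show ?thesis using that(3) unfolding B_def metric_closure_of
      by (auto simp: norm_distance_def split: if_splits)
  qed
  show ?thesis
  proof
    fix x e assume x: "x \<in> E" "N x < r" and e: "(e::real) > 0"
    obtain y where y: "y \<in> E" "q y \<le> real n" "N (x0 + x - y) < e"
      using approx[of "x0 + x" e] x x0 e subspace_add[OF sub] by auto
    obtain z where z: "z \<in> E" "q z \<le> real n" "N (x0 - x - z) < e"
      using approx[of "x0 - x" e] x x0 e subspace_diff[OF sub] norm_on_minus[OF nrm] by auto
    have "q ((1/2) *\<^sub>R (y - z)) \<le> real n"
      using norm_onD(3)[OF q subspace_diff[OF sub y(1) z(1)], of "1/2"]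
        norm_on_diff_le[OF q sub y(1) z(1)] y z by simp
    moreover
    have mem: "x0 + x - y \<in> E" "x0 - x - z \<in> E"
      using x x0 y z by (simp_all add: subspace_diff[OF sub] subspace_add[OF sub])
    have "x - (1/2) *\<^sub>R (y - z) = (1/2) *\<^sub>R ((x0 + x - y) - (x0 - x - z))"
    proof -
      have "(x0 + x - y) - (x0 - x - z) = 2 *\<^sub>R x - (y - z)"
        by (simp add: scaleR_2)
      then show ?thesis by (simp only: scaleR_diff_right scaleR_scaleR) simp
    qed
    then have "N (x - (1/2) *\<^sub>R (y - z)) < e"
      using norm_onD(3)[OF nrm subspace_diff[OF sub mem], of "1/2"]
        norm_on_diff_le[OF nrm sub mem] y z by simp
    ultimately show "\<exists>y\<in>E. q y \<le> real n \<and> N (x - y) < e"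
      using y z by (meson subspace_diff[OF sub] subspace_scale[OF sub])
  qed (use r in auto)
qed

lemma proper_bsf_tendsto_pointwise:
  assumes "proper_bsf E N" "\<And>n. s n \<in> E" "l \<in> E" "(\<lambda>n. N (s n - l)) \<longlonglongrightarrow> 0"
  shows "(\<lambda>n. s n x) \<longlonglongrightarrow> l x"
proof (rule tendstoI)
  fix e :: real assume "e > 0"
  with assms(1,3) obtain d where "d > 0" and d: "\<And>w. w \<in> E \<Longrightarrow> N (w - l) < d \<Longrightarrow> \<bar>w x - l x\<bar> < e"
    unfolding proper_bsf_def continuous_functional_on_def by meson
  have "\<forall>\<^sub>F n in sequentially. N (s n - l) < d"
    using assms(4) \<open>d > 0\<close> by (rule order_tendstoD(2))
  then show "\<forall>\<^sub>F n in sequentially. dist (s n x) (l x) < e"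
    by eventually_elim (simp add: dist_real_def d assms(2))
qed

text \<open>
  This is the closed graph theorem for inclusions. The graph is closed because both limits are
  pointwise limits, so a sequence that converges in both norms has only one candidate limit. Lemma
  \<open>sublevel_dense_in_ball\<close> approximates a small \<open>x\<close> in the norm of \<open>E\<close> by elements whose norm in \<open>F\<close> is
  controlled; correcting the error again and again, with geometrically decreasing bounds, gives a
  sequence that converges to \<open>x\<close> in \<open>E\<close> and is Cauchy in \<open>F\<close>. Completeness of \<open>F\<close> and continuity of
  the evaluations identify its limit in \<open>F\<close> with \<open>x\<close>.
\<close>

theorem proper_bsf_inclusion_bounded:
  fixes E F :: "('x \<Rightarrow> real) set"
  assumes E: "proper_bsf E N" and F: "proper_bsf F q" and "E \<subseteq> F"
  obtains C where "0 \<le> C" "\<And>x. x \<in> E \<Longrightarrow> q x \<le> C * N x"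
proof -
  have bE: "banach_space_on E N" and subE: "subspace E" and nE: "norm_on E N"
    and subF: "subspace F" and nF: "norm_on F q" and cF: "complete_norm_on F q"
    using E F by (auto simp: proper_bsf_def bsf_def banach_space_on_def)
  have nEq: "norm_on E q" using nF \<open>E \<subseteq> F\<close> by (rule norm_on_subset)
  obtain K r where "0 \<le> K" "0 < r" and
    dense: "\<And>x e. x \<in> E \<Longrightarrow> N x < r \<Longrightarrow> 0 < e \<Longrightarrow> \<exists>y\<in>E. q y \<le> K \<and> N (x - y) < e"
    using sublevel_dense_in_ball[OF bE nEq] by metis
  have dense_scaled: "\<exists>y\<in>E. q y \<le> K / 2 ^ k \<and> N (x - y) < r / 2 ^ Suc k"
    if x: "x \<in> E" "N x < r / 2 ^ k" for x k
  proof -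
    have "N ((2 ^ k) *\<^sub>R x) < r"
      using x norm_onD(3)[OF nE x(1), of "2 ^ k"] by (simp add: field_simps)
    then obtain y where y: "y \<in> E" "q y \<le> K" "N ((2 ^ k) *\<^sub>R x - y) < r / 2"
      using dense[of "(2 ^ k) *\<^sub>R x" "r / 2"] x \<open>r > 0\<close> subspace_scale[OF subE] by auto
    have eq: "x - (1 / 2 ^ k) *\<^sub>R y = (1 / 2 ^ k) *\<^sub>R ((2 ^ k) *\<^sub>R x - y)"
      by (simp add: scaleR_diff_right)
    have "N (x - (1 / 2 ^ k) *\<^sub>R y) < r / 2 ^ Suc k"
      unfolding eq using y norm_onD(3)[OF nE, of "(2 ^ k) *\<^sub>R x - y" "1 / 2 ^ k"] x
      by (simp add: subspace_diff[OF subE] subspace_scale[OF subE] field_simps)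
    moreover have "q ((1 / 2 ^ k) *\<^sub>R y) \<le> K / 2 ^ k"
      using norm_onD(3)[OF nEq y(1), of "1 / 2 ^ k"] y(2) by (simp add: field_simps)
    ultimately show ?thesis using subspace_scale[OF subE y(1)] by blast
  qed
  have small: "q x \<le> 2 * K" if x: "x \<in> E" "N x < r" for x
  proof -
    \<comment> \<open>Successive approximations: \<open>s (Suc k)\<close> adds to \<open>s k\<close> an approximation of the error \<open>x - s k\<close>.\<close>
    have "\<exists>s. \<forall>k. (s k \<in> E \<and> N (x - s k) < r / 2 ^ k \<and> (k = 0 \<longrightarrow> s k = 0)) \<and>
        q (s (Suc k) - s k) \<le> K / 2 ^ k"
    proof (rule dependent_nat_choice)
      show "\<exists>y. y \<in> E \<and> N (x - y) < r / 2 ^ 0 \<and> (0 = (0::nat) \<longrightarrow> y = 0)"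
        using x subspace_0[OF subE] by (intro exI[of _ 0]) simp
    next
      fix y and k :: nat
      assume y: "y \<in> E \<and> N (x - y) < r / 2 ^ k \<and> (k = 0 \<longrightarrow> y = 0)"
      then obtain z where z: "z \<in> E" "q z \<le> K / 2 ^ k" "N (x - y - z) < r / 2 ^ Suc k"
        using dense_scaled[of "x - y" k] subspace_diff[OF subE x(1)] by blast
      show "\<exists>w. (w \<in> E \<and> N (x - w) < r / 2 ^ Suc k \<and> (Suc k = 0 \<longrightarrow> w = 0)) \<and>
          q (w - y) \<le> K / 2 ^ k"
        using z y subspace_add[OF subE] by (intro exI[of _ "y + z"]) (simp add: diff_diff_eq)
    qed
    then obtain s where s: "\<forall>k. (s k \<in> E \<and> N (x - s k) < r / 2 ^ k \<and> (k = 0 \<longrightarrow> s k = 0)) \<and>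
        q (s (Suc k) - s k) \<le> K / 2 ^ k"
      by (elim exE)
    have sE: "s k \<in> E" and sN: "N (x - s k) < r / 2 ^ k"
      and step: "q (s (Suc k) - s k) \<le> K / 2 ^ k" for k
      using s by simp_all
    have s0: "s 0 = 0"
      using s[rule_format, of 0] by simp
    have sF: "s k \<in> F" for k using sE \<open>E \<subseteq> F\<close> by blast
    \<comment> \<open>The subtracted term makes the geometric series telescope in the induction.\<close>
    have tail: "q (s (k + j) - s k) \<le> 2 * K / 2 ^ k - 2 * K / 2 ^ (k + j)" for k j
    proof (induction j)
      case 0
      have "s (k + 0) - s k = 0" by (simp only: add_0_right diff_self)
      then have "q (s (k + 0) - s k) = 0" using norm_on_zero[OF nF subF] by (simp only:)
      then show ?case by (simp only: add_0_right diff_self order_refl)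
    next
      case (Suc j)
      have "q (s (k + Suc j) - s k) \<le> q (s (Suc (k + j)) - s (k + j)) + q (s (k + j) - s k)"
        using norm_on_diff_triangle[OF nF subF sF sF sF] by simp
      also have "\<dots> \<le> K / 2 ^ (k + j) + (2 * K / 2 ^ k - 2 * K / 2 ^ (k + j))"
        using step Suc by (intro add_mono)
      also have "\<dots> = 2 * K / 2 ^ k - 2 * K / 2 ^ (k + Suc j)"
        by (simp add: field_simps)
      finally show ?case .
    qed
    have tail': "q (s (k + j) - s k) \<le> 2 * K * (1/2) ^ k" for k j
    proof -
      have "0 \<le> 2 * K / 2 ^ (k + j)" using \<open>0 \<le> K\<close> by simp
      then have "q (s (k + j) - s k) \<le> 2 * K / 2 ^ k" using tail[of k j] by linarith
      then show ?thesis by (simp add: power_divide)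
    qed
    have "(\<lambda>k. (1/2 :: real) ^ k) \<longlonglongrightarrow> 0"
      by (rule LIMSEQ_realpow_zero) simp_all
    then have geometric: "(\<lambda>k. c * (1/2) ^ k) \<longlonglongrightarrow> 0" for c :: real
      using tendsto_mult_left[of "\<lambda>k. (1/2) ^ k" 0 sequentially c] by simp
    have Cauchy: "\<exists>J. \<forall>m\<ge>J. \<forall>n\<ge>J. q (s m - s n) < e" if "e > 0" for e
    proof -
      have "\<forall>\<^sub>F k in sequentially. 2 * K * (1/2) ^ k < e"
        using geometric \<open>e > 0\<close> by (rule order_tendstoD(2))
      then obtain J where J: "\<And>k. k \<ge> J \<Longrightarrow> 2 * K * (1/2) ^ k < e"
        unfolding eventually_sequentially by blast
      have "q (s m - s n) < e" if "n \<ge> J" "n \<le> m" for m n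
        using tail'[of n "m - n"] J[of n] that by simp
      then show ?thesis
        using norm_on_diff_commute[OF nF subF sF sF] by (metis nle_le)
    qed
    have "\<exists>l\<in>F. (\<lambda>n. q (s n - l)) \<longlonglongrightarrow> 0"
      using cF[unfolded complete_norm_on_def, rule_format, of s] sF Cauchy by simp
    then obtain l where lF: "l \<in> F" and l: "(\<lambda>n. q (s n - l)) \<longlonglongrightarrow> 0"
      by (elim bexE)
    have limE: "(\<lambda>k. N (s k - x)) \<longlonglongrightarrow> 0"
    proof (rule tendsto_sandwich)
      show "\<forall>\<^sub>F k in sequentially. 0 \<le> N (s k - x)"
        using norm_onD(1)[OF nE] subspace_diff[OF subE sE x(1)] by simp
      show "\<forall>\<^sub>F k in sequentially. N (s k - x) \<le> r * (1/2) ^ k"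
        using sN norm_on_diff_commute[OF nE subE sE x(1)]
        by (intro always_eventually allI) (simp add: power_divide less_imp_le)
      show "(\<lambda>k. r * (1/2) ^ k) \<longlonglongrightarrow> 0"
        by (rule geometric)
    qed auto
    have "l = x"
    proof
      fix t
      show "l t = x t"
        using proper_bsf_tendsto_pointwise[OF F sF lF l, of t]
          proper_bsf_tendsto_pointwise[OF E sE x(1) limE, of t]
        by (rule LIMSEQ_unique)
    qed
    have "q x \<le> 2 * K + q (s k - l)" for k
      using norm_on_diff_triangle[OF nF subF lF sF[of k] subspace_0[OF subF]] tail'[of 0 k]
        norm_on_diff_commute[OF nF subF sF[of k] lF] \<open>l = x\<close> s0 by simp
    moreover have "(\<lambda>k. 2 * K + q (s k - l)) \<longlonglongrightarrow> 2 * K + 0"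
      by (intro tendsto_intros l)
    ultimately have "q x \<le> 2 * K + 0"
      by (intro LIMSEQ_le_const) auto
    then show ?thesis by simp
  qed
  show ?thesis
  proof
    show "0 \<le> 4 * K / r" using \<open>0 \<le> K\<close> \<open>0 < r\<close> by simp
    fix x assume x: "x \<in> E"
    show "q x \<le> 4 * K / r * N x"
    proof (cases "N x = 0")
      case True
      then have "x = 0" using norm_onD(2)[OF nE x] by simp
      then show ?thesis using norm_on_zero[OF nF subF] norm_on_zero[OF nE subE] by simp
    next
      case False
      define c where "c = r / (2 * N x)"
      have "c > 0" using False norm_onD(1)[OF nE x] \<open>0 < r\<close> by (simp add: c_def)
      have "c * N x = r / 2" using False by (simp add: c_def)
      then have "N (c *\<^sub>R x) < r"
        using norm_onD(3)[OF nE x, of c] \<open>c > 0\<close> \<open>0 < r\<close> by simp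
      then have "q (c *\<^sub>R x) \<le> 2 * K" by (rule small[OF subspace_scale[OF subE x]])
      then have "c * q x \<le> 2 * K" using norm_onD(3)[OF nEq x, of c] \<open>c > 0\<close> by simp
      then have "q x \<le> 2 * K / c" using \<open>c > 0\<close> by (simp add: field_simps)
      also have "2 * K / c = 4 * K / r * N x" by (simp add: c_def field_simps)
      finally show ?thesis .
    qed
  qed
qed

section \<open>Averages over all choices of signs\<close>

text \<open>
  A choice of signs for \<open>{..<n}\<close> is encoded by the set \<open>T\<close> of the indices that carry the sign
  \<open>+1\<close>, so that all choices are the subsets of \<open>{..<n}\<close>. The point of this encoding is that passing
  from \<open>n\<close> to \<open>Suc n\<close> pairs every \<open>T\<close> with \<open>insert n T\<close>.
\<close>

definition sign_sum :: "nat \<Rightarrow> (nat \<Rightarrow> 'a::real_vector) \<Rightarrow> nat set \<Rightarrow> 'a" where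
  "sign_sum n x T = (\<Sum>i<n. (if i \<in> T then 1 else - 1) *\<^sub>R x i)"

definition sign_mean :: "nat \<Rightarrow> (nat set \<Rightarrow> real) \<Rightarrow> real" where
  "sign_mean n h = (\<Sum>T\<in>Pow {..<n}. h T) / 2 ^ n"

lemma sign_mean_mono:
  "(\<And>T. T \<subseteq> {..<n} \<Longrightarrow> h T \<le> k T) \<Longrightarrow> sign_mean n h \<le> sign_mean n k"
  unfolding sign_mean_def by (intro divide_right_mono sum_mono) auto

lemma sign_mean_cmult: "sign_mean n (\<lambda>T. c * h T) = c * sign_mean n h"
  by (simp add: sign_mean_def flip: sum_distrib_left)

lemma sign_mean_const [simp]: "sign_mean n (\<lambda>T. c) = c"
  by (simp add: sign_mean_def card_Pow)

lemma sign_mean_add: "sign_mean n (\<lambda>T. h T + k T) = sign_mean n h + sign_mean n k"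
  by (simp add: sign_mean_def sum.distrib add_divide_distrib)

lemma sign_mean_diff: "sign_mean n (\<lambda>T. h T - k T) = sign_mean n h - sign_mean n k"
  by (simp add: sign_mean_def sum_subtractf diff_divide_distrib)

text \<open>
  The next two lemmas take the place of conditioning on all signs but the last one; every moment
  computation below is an induction through them.
\<close>

lemma sign_mean_Suc:
  "sign_mean (Suc n) h = sign_mean n (\<lambda>T. (h T + h (insert n T)) / 2)"
proof -
  have disj: "Pow {..<n} \<inter> insert n ` Pow {..<n} = {}" by auto
  have inj: "inj_on (insert n) (Pow {..<n})"
    by (rule inj_onI) (metis PowD insert_ident lessThan_iff less_irrefl subset_iff)
  have "(\<Sum>T\<in>Pow {..<Suc n}. h T) = (\<Sum>T\<in>Pow {..<n}. h T + h (insert n T))"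
    unfolding lessThan_Suc Pow_insert using disj inj
    by (subst sum.union_disjoint) (simp_all add: sum.reindex sum.distrib)
  then show ?thesis
    by (simp add: sign_mean_def sum_divide_distrib mult.commute)
qed

lemma sign_mean_sum_Suc:
  "sign_mean (Suc n) (\<lambda>T. h (sign_sum (Suc n) x T)) =
   sign_mean n (\<lambda>T. (h (sign_sum n x T - x n) + h (sign_sum n x T + x n)) / 2)"
proof -
  have cong: "sign_mean n h = sign_mean n k" if "\<And>T. T \<subseteq> {..<n} \<Longrightarrow> h T = k T" for h k
    using that by (simp add: sign_mean_def)
  have "sign_sum (Suc n) x T = sign_sum n x T - x n" if "T \<subseteq> {..<n}" for T
    using that by (auto simp: sign_sum_def)
  moreover have "sign_sum (Suc n) x (insert n T) = sign_sum n x T + x n" for T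
    unfolding sign_sum_def by (simp cong: sum.cong_simp)
  ultimately show ?thesis
    unfolding sign_mean_Suc by (intro cong) simp
qed

lemma sign_sum_in_subspace:
  "subspace V \<Longrightarrow> (\<And>i. i < n \<Longrightarrow> x i \<in> V) \<Longrightarrow> sign_sum n x T \<in> V"
  unfolding sign_sum_def by (intro subspace_sum subspace_scale) auto

text \<open>Jensen's inequality for the square, from the nonnegativity of the variance.\<close>

lemma sign_mean_power2_le: "(sign_mean n h)\<^sup>2 \<le> sign_mean n (\<lambda>T. (h T)\<^sup>2)"
proof -
  define m where "m = sign_mean n h"
  have "0 \<le> sign_mean n (\<lambda>T. (h T - m)\<^sup>2)"
    unfolding sign_mean_def by (intro divide_nonneg_nonneg sum_nonneg) auto
  also have "(\<lambda>T. (h T - m)\<^sup>2) = (\<lambda>T. (h T)\<^sup>2 - (2 * m) * h T + m\<^sup>2)"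
    by (simp add: fun_eq_iff power2_eq_square algebra_simps)
  also have "sign_mean n \<dots> = sign_mean n (\<lambda>T. (h T)\<^sup>2) - 2 * m * m + m\<^sup>2"
    unfolding sign_mean_add sign_mean_diff sign_mean_cmult m_def by simp
  finally show ?thesis by (simp add: m_def power2_eq_square)
qed

text \<open>
  A first moment is bounded below once the second moment is known and the fourth moment is
  comparable to the square of the second one. In place of an interpolation inequality between
  \<open>L\<^sup>p\<close> norms, it suffices to integrate the pointwise bound \<open>u \<ge> u\<^sup>2 - (4 / 27) * u ^ 4\<close> for
  \<open>u = h / \<sigma>\<close>: the right-hand side has mean at least \<open>1 - (4 / 27) * 3 = 5 / 9\<close>.
\<close>

lemma sign_mean_power_interpolation:
  assumes pos: "\<And>T. T \<subseteq> {..<n} \<Longrightarrow> 0 \<le> h T"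
    and second: "sign_mean n (\<lambda>T. (h T)\<^sup>2) = \<sigma>\<^sup>2" and "0 \<le> \<sigma>"
    and fourth: "sign_mean n (\<lambda>T. (h T) ^ 4) \<le> 3 * \<sigma> ^ 4"
  shows "5 / 9 * \<sigma> \<le> sign_mean n h"
proof (cases "\<sigma> = 0")
  case True
  then show ?thesis
    using sign_mean_mono[of n "\<lambda>_. 0" h] pos by simp
next
  case False
  then have "\<sigma> > 0" using \<open>0 \<le> \<sigma>\<close> by simp
  have pointwise: "1 / \<sigma> * t\<^sup>2 - 4 / (27 * \<sigma> ^ 3) * t ^ 4 \<le> t" if "t \<ge> 0" for t
  proof -
    define u where "u = t / \<sigma>"
    have t: "t = \<sigma> * u" using \<open>\<sigma> > 0\<close> by (simp add: u_def)
    have "u \<ge> 0" using that \<open>\<sigma> > 0\<close> by (simp add: u_def)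
    \<comment> \<open>The factor \<open>4 / 27\<close> makes the cubic \<open>1 - u + (4 / 27) * u ^ 3\<close> have a double zero at \<open>u = 3 / 2\<close>.\<close>
    then have "0 \<le> u * ((u / 3 + 1) * (2 * u / 3 - 1)\<^sup>2)" by simp
    also have "\<dots> = u - (u\<^sup>2 - 4 / 27 * u ^ 4)"
      by (simp add: field_simps power2_eq_square power4_eq_xxxx)
    finally have "\<sigma> * (u\<^sup>2 - 4 / 27 * u ^ 4) \<le> \<sigma> * u"
      using \<open>\<sigma> > 0\<close> by simp
    also have "\<sigma> * (u\<^sup>2 - 4 / 27 * u ^ 4) = 1 / \<sigma> * t\<^sup>2 - 4 / (27 * \<sigma> ^ 3) * t ^ 4"
      using \<open>\<sigma> > 0\<close> unfolding t
      by (simp add: field_simps power2_eq_square power3_eq_cube power4_eq_xxxx)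
    finally show ?thesis by (simp add: t)
  qed
  have "5 / 9 * \<sigma> = 1 / \<sigma> * \<sigma>\<^sup>2 - 4 / (27 * \<sigma> ^ 3) * (3 * \<sigma> ^ 4)"
    using \<open>\<sigma> > 0\<close> by (simp add: field_simps power2_eq_square power3_eq_cube power4_eq_xxxx)
  also have "\<dots> \<le> 1 / \<sigma> * \<sigma>\<^sup>2 - 4 / (27 * \<sigma> ^ 3) * sign_mean n (\<lambda>T. (h T) ^ 4)"
    using fourth \<open>\<sigma> > 0\<close> by (intro diff_left_mono mult_left_mono) auto
  also have "\<dots> = sign_mean n (\<lambda>T. 1 / \<sigma> * (h T)\<^sup>2 - 4 / (27 * \<sigma> ^ 3) * (h T) ^ 4)"
    unfolding sign_mean_diff sign_mean_cmult second ..
  also have "\<dots> \<le> sign_mean n h"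
    using pos pointwise by (intro sign_mean_mono) blast
  finally show ?thesis .
qed

section \<open>Moments of sign sums in Hilbert spaces\<close>

lemma inner_product_onD:
  assumes "inner_product_on V ip" "u \<in> V" "v \<in> V"
  shows "ip u v = ip v u" and "w \<in> V \<Longrightarrow> ip (u + v) w = ip u w + ip v w"
    and "ip (c *\<^sub>R u) v = c * ip u v" and "0 \<le> ip u u"
  using assms unfolding inner_product_on_def by simp_all

lemma inner_product_on_square_add_scaleR:
  assumes ip: "inner_product_on V ip" and V: "subspace V" "u \<in> V" "v \<in> V"
  shows "ip (u + c *\<^sub>R v) (u + c *\<^sub>R v) = ip u u + 2 * c * ip u v + c\<^sup>2 * ip v v"
proof -
  have mem: "c *\<^sub>R v \<in> V" "u + c *\<^sub>R v \<in> V" using V by (simp_all add: subspace_scale subspace_add)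
  have expand: "ip (u + c *\<^sub>R v) w = ip u w + c * ip v w" if "w \<in> V" for w
    using inner_product_onD(2)[OF ip V(2) mem(1) that] inner_product_onD(3)[OF ip V(3) that] by simp
  have "ip (u + c *\<^sub>R v) (u + c *\<^sub>R v) = ip (u + c *\<^sub>R v) u + c * ip (u + c *\<^sub>R v) v"
    using expand[OF mem(2)] inner_product_onD(1)[OF ip mem(2)] V by simp
  then show ?thesis
    using expand V inner_product_onD(1)[OF ip V(2,3)] by (simp add: algebra_simps power2_eq_square)
qed

lemma inner_product_on_square_add_diff:
  assumes "inner_product_on V ip" "subspace V" "u \<in> V" "v \<in> V"
  shows "ip (u + v) (u + v) = ip u u + 2 * ip u v + ip v v"
    and "ip (u - v) (u - v) = ip u u - 2 * ip u v + ip v v"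
  using inner_product_on_square_add_scaleR[OF assms, of 1]
    inner_product_on_square_add_scaleR[OF assms, of "-1"] by simp_all

lemma inner_product_on_Cauchy_Schwarz:
  assumes ip: "inner_product_on V ip" and V: "subspace V" "u \<in> V" "v \<in> V"
  shows "(ip u v)\<^sup>2 \<le> ip u u * ip v v"
proof -
  define a b c where "a = ip u u" and "b = ip u v" and "c = ip v v"
  have q: "0 \<le> a + 2 * t * b + t\<^sup>2 * c" for t
    using inner_product_on_square_add_scaleR[OF ip V, of t]
      inner_product_onD(4)[OF ip, of "u + t *\<^sub>R v"] V
    by (simp add: a_def b_def c_def subspace_add subspace_scale)
  have "c \<ge> 0" using inner_product_onD(4)[OF ip V(3) V(3)] by (simp add: c_def)
  have "b\<^sup>2 \<le> a * c"
  proof (cases "c = 0")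
    case True
    have "b = 0"
    proof (rule ccontr)
      assume "b \<noteq> 0"
      \<comment> \<open>This \<open>t\<close> makes the affine function \<open>a + 2 * t * b\<close> equal to \<open>- 1\<close>.\<close>
      then have "2 * (- (a + 1) / (2 * b)) * b = - (a + 1)" by simp
      then show False using q[of "- (a + 1) / (2 * b)"] True by simp
    qed
    then show ?thesis using True by simp
  next
    case False
    then have "0 \<le> c * (a + 2 * (- b / c) * b + (- b / c)\<^sup>2 * c)"
      using q[of "- b / c"] \<open>c \<ge> 0\<close> by (intro mult_nonneg_nonneg) auto
    also have "\<dots> = a * c - b\<^sup>2"
      using False by (simp add: field_simps power2_eq_square)
    finally show ?thesis by simp
  qed
  then show ?thesis by (simp add: a_def b_def c_def)
qed

text \<open>
  The parallelogram law removes one vector at a time; equivalently, Rademacher variables are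
  orthonormal.
\<close>

lemma sign_mean_inner_square:
  assumes ip: "inner_product_on V ip" and V: "subspace V" and x: "\<And>i. i < n \<Longrightarrow> x i \<in> V"
  shows "sign_mean n (\<lambda>T. ip (sign_sum n x T) (sign_sum n x T)) = (\<Sum>i<n. ip (x i) (x i))"
  using x
proof (induction n)
  case 0
  have "ip 0 0 = 0" using inner_product_onD(3)[OF ip, of 0 0 0] subspace_0[OF V] by simp
  then show ?case by (simp add: sign_sum_def)
next
  case (Suc n)
  let ?S = "sign_sum n x"
  have mem: "?S T \<in> V" "x n \<in> V" for T
    using Suc.prems by (auto intro: sign_sum_in_subspace[OF V])
  have "(ip (?S T - x n) (?S T - x n) + ip (?S T + x n) (?S T + x n)) / 2 =
      ip (?S T) (?S T) + ip (x n) (x n)" for T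
    using inner_product_on_square_add_diff[OF ip V mem] by simp
  then show ?case
    using Suc by (simp only: sign_mean_sum_Suc[of n "\<lambda>v. ip v v" x])
      (simp add: sign_mean_add)
qed

text \<open>
  With \<open>a\<close> the squared norm of the partial sum \<open>S\<close>, \<open>b\<close> that of the new vector \<open>v\<close>, and \<open>d\<close> the inner
  product of \<open>S\<close> and \<open>v\<close>, averaging over the two signs gives \<open>(a + b)\<^sup>2 + 4 * d\<^sup>2 \<le> a\<^sup>2 + 6 * a * b + b\<^sup>2\<close> by the
  Cauchy-Schwarz inequality. The constant 3 is what makes the cross term \<open>6 * a * b\<close> complete the
  square \<open>3 * (a + b)\<^sup>2\<close>.
\<close>

lemma sign_mean_inner_fourth_power:
  assumes ip: "inner_product_on V ip" and V: "subspace V" and x: "\<And>i. i < n \<Longrightarrow> x i \<in> V"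
  shows "sign_mean n (\<lambda>T. (ip (sign_sum n x T) (sign_sum n x T))\<^sup>2) \<le> 3 * (\<Sum>i<n. ip (x i) (x i))\<^sup>2"
  using x
proof (induction n)
  case 0
  have "ip 0 0 = 0" using inner_product_onD(3)[OF ip, of 0 0 0] subspace_0[OF V] by simp
  then show ?case by (simp add: sign_sum_def)
next
  case (Suc n)
  let ?S = "sign_sum n x"
  define b where "b = ip (x n) (x n)"
  define s where "s = (\<Sum>i<n. ip (x i) (x i))"
  have mem: "?S T \<in> V" "x n \<in> V" for T
    using Suc.prems by (auto intro: sign_sum_in_subspace[OF V])
  have step: "((ip (?S T - x n) (?S T - x n))\<^sup>2 + (ip (?S T + x n) (?S T + x n))\<^sup>2) / 2 \<le>
      (ip (?S T) (?S T))\<^sup>2 + (6 * b) * ip (?S T) (?S T) + b\<^sup>2" for T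
    using inner_product_on_Cauchy_Schwarz[OF ip V mem, of T]
    unfolding inner_product_on_square_add_diff[OF ip V mem] b_def[symmetric]
    by (simp add: power2_eq_square algebra_simps)
  have "sign_mean (Suc n) (\<lambda>T. (ip (sign_sum (Suc n) x T) (sign_sum (Suc n) x T))\<^sup>2) \<le>
      sign_mean n (\<lambda>T. (ip (?S T) (?S T))\<^sup>2 + (6 * b) * ip (?S T) (?S T) + b\<^sup>2)"
    unfolding sign_mean_sum_Suc[of n "\<lambda>v. (ip v v)\<^sup>2" x] by (intro sign_mean_mono step)
  also have "\<dots> = sign_mean n (\<lambda>T. (ip (?S T) (?S T))\<^sup>2) + 6 * b * s + b\<^sup>2"
    using sign_mean_inner_square[OF ip V, of n x] Suc.prems
    by (simp add: sign_mean_add sign_mean_cmult s_def)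
  also have "\<dots> \<le> 3 * s\<^sup>2 + 6 * b * s + 3 * b\<^sup>2"
    using Suc by (simp add: s_def add_mono)
  also have "\<dots> = 3 * (\<Sum>i<Suc n. ip (x i) (x i))\<^sup>2"
    by (simp add: s_def b_def power2_eq_square algebra_simps)
  finally show ?case .
qed

text \<open>
  The first bound says that a Hilbert space has type 2; the second, the Khintchine inequality with
  Hilbert space values, says that it has cotype 2.
\<close>

theorem Hilbert_sign_mean_bounds:
  assumes H: "hilbert_norm_on V N" and V: "subspace V" and x: "\<And>i. i < n \<Longrightarrow> x i \<in> V"
  shows "sign_mean n (\<lambda>T. N (sign_sum n x T)) \<le> sqrt (\<Sum>i<n. (N (x i))\<^sup>2)"
    and "5 / 9 * sqrt (\<Sum>i<n. (N (x i))\<^sup>2) \<le> sign_mean n (\<lambda>T. N (sign_sum n x T))"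
proof -
  obtain ip where ip: "inner_product_on V ip" and N: "\<And>v. v \<in> V \<Longrightarrow> N v = sqrt (ip v v)"
    using H unfolding hilbert_norm_on_def by blast
  have S: "sign_sum n x T \<in> V" for T using x by (rule sign_sum_in_subspace[OF V])
  have N2: "(N v)\<^sup>2 = ip v v" and N0: "0 \<le> N v" if "v \<in> V" for v
    using N[OF that] inner_product_onD(4)[OF ip that that] by simp_all
  have N4: "(N v) ^ 4 = (ip v v)\<^sup>2" if "v \<in> V" for v
    using N2[OF that] by (metis num_double numeral_times_numeral power_mult)
  define \<sigma> where "\<sigma> = sqrt (\<Sum>i<n. (N (x i))\<^sup>2)"
  have "0 \<le> \<sigma>" by (simp add: \<sigma>_def sum_nonneg)
  have \<sigma>2: "\<sigma>\<^sup>2 = (\<Sum>i<n. ip (x i) (x i))"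
  proof -
    have "\<sigma>\<^sup>2 = (\<Sum>i<n. (N (x i))\<^sup>2)" by (simp add: \<sigma>_def sum_nonneg)
    also have "\<dots> = (\<Sum>i<n. ip (x i) (x i))" using x N2 by (intro sum.cong) auto
    finally show ?thesis .
  qed
  have second: "sign_mean n (\<lambda>T. (N (sign_sum n x T))\<^sup>2) = \<sigma>\<^sup>2"
    using sign_mean_inner_square[OF ip V x] by (simp add: N2[OF S] \<sigma>2)
  have "\<sigma> ^ 4 = (\<sigma>\<^sup>2)\<^sup>2" by simp
  then have fourth: "sign_mean n (\<lambda>T. (N (sign_sum n x T)) ^ 4) \<le> 3 * \<sigma> ^ 4"
    using sign_mean_inner_fourth_power[OF ip V x] by (simp add: N4[OF S] \<sigma>2)
  show "5 / 9 * sqrt (\<Sum>i<n. (N (x i))\<^sup>2) \<le> sign_mean n (\<lambda>T. N (sign_sum n x T))"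
    unfolding \<sigma>_def[symmetric]
    by (rule sign_mean_power_interpolation[OF N0[OF S] second \<open>0 \<le> \<sigma>\<close> fourth])
  show "sign_mean n (\<lambda>T. N (sign_sum n x T)) \<le> sqrt (\<Sum>i<n. (N (x i))\<^sup>2)"
    unfolding \<sigma>_def[symmetric]
    using sign_mean_power2_le[of n "\<lambda>T. N (sign_sum n x T)"] \<open>0 \<le> \<sigma>\<close>
    unfolding second by (rule power2_le_imp_le)
qed

section \<open>Expectations of Rademacher sums as sign averages\<close>

text \<open>
  The underlying probability space need not be complete, so measurability of the norm of a
  Rademacher sum does not follow from its taking finitely many values almost surely. It follows
  from the continuity shown here, where \<open>nat \<Rightarrow> real\<close> carries the product topology.
\<close>

lemma norm_on_linear_combination_continuous:
  assumes nrm: "norm_on V N" and V: "subspace V" and x: "\<And>i. i < n \<Longrightarrow> x i \<in> V"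
  shows "continuous_on UNIV (\<lambda>a::nat \<Rightarrow> real. N (\<Sum>i<n. a i *\<^sub>R x i))"
proof -
  let ?v = "\<lambda>a::nat \<Rightarrow> real. \<Sum>i<n. a i *\<^sub>R x i"
  have mem: "?v a \<in> V" for a
    using x by (intro subspace_sum[OF V] subspace_scale[OF V]) auto
  have diff: "N (?v a - ?v b) \<le> (\<Sum>i<n. \<bar>a i - b i\<bar> * N (x i))" for a b
  proof -
    have "?v a - ?v b = (\<Sum>i<n. (a i - b i) *\<^sub>R x i)"
      by (simp add: scaleR_diff_left sum_subtractf)
    then have "N (?v a - ?v b) \<le> (\<Sum>i<n. N ((a i - b i) *\<^sub>R x i))"
      using norm_on_sum_le[OF nrm V, of "{..<n}" "\<lambda>i. (a i - b i) *\<^sub>R x i"] x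
        subspace_scale[OF V] by simp
    also have "\<dots> = (\<Sum>i<n. \<bar>a i - b i\<bar> * N (x i))"
      using x by (intro sum.cong) (simp_all add: norm_onD(3)[OF nrm])
    finally show ?thesis .
  qed
  have Lipschitz: "\<bar>N (?v a) - N (?v b)\<bar> \<le> (\<Sum>i<n. \<bar>a i - b i\<bar> * N (x i))" for a b
    using norm_on_diff_triangle[OF nrm V mem mem subspace_0[OF V], of a b]
      norm_on_diff_triangle[OF nrm V mem mem subspace_0[OF V], of b a]
      diff[of a b] norm_on_diff_commute[OF nrm V mem mem, of a b] by (simp add: abs_le_iff)
  have "((\<lambda>a. N (?v a)) \<longlongrightarrow> N (?v b)) (at b)" for b
  proof -
    have coord: "((\<lambda>a. a i) \<longlongrightarrow> b i) (at b)" for i :: nat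
    proof -
      have "continuous_on UNIV (\<lambda>a::nat \<Rightarrow> real. a i)" by simp
      then show ?thesis by (simp add: continuous_on_def)
    qed
    have lim: "((\<lambda>a. \<Sum>i<n. \<bar>a i - b i\<bar> * N (x i)) \<longlongrightarrow> (\<Sum>i<n. \<bar>b i - b i\<bar> * N (x i))) (at b)"
      by (intro tendsto_intros coord)
    have "((\<lambda>a. N (?v a) - N (?v b)) \<longlongrightarrow> 0) (at b)"
      by (rule Lim_null_comparison[OF _ lim[simplified]]) (simp add: Lipschitz)
    then show ?thesis by (simp add: LIM_zero_iff)
  qed
  then show ?thesis by (simp add: continuous_on_def)
qed

context rademacher_sequence
begin

lemma random_variable_signs [measurable]: "\<epsilon> i \<in> borel_measurable M"
  using indep unfolding indep_vars_def by blast

lemma prob_sign_pattern: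
  "prob {\<omega> \<in> space M. \<forall>i<n. \<epsilon> i \<omega> = (if i \<in> T then 1 else - 1)} = 1 / 2 ^ n"
proof (cases "n = 0")
  case True
  then show ?thesis by (simp add: prob_space)
next
  case False
  define A where "A i = {if i \<in> T then 1 else - 1 :: real}" for i
  have "{\<omega> \<in> space M. \<forall>i<n. \<epsilon> i \<omega> = (if i \<in> T then 1 else - 1)} =
      (\<Inter>i\<in>{..<n}. \<epsilon> i -` A i \<inter> space M)"
    using False by (auto simp: A_def)
  also have "prob \<dots> = (\<Prod>i<n. prob (\<epsilon> i -` A i \<inter> space M))"
    using indep False unfolding indep_vars_def2
    by (intro indep_setsD[of _ UNIV]) (auto simp: A_def)
  also have "\<dots> = (\<Prod>i<n. 1 / 2)"
  proof (rule prod.cong)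
    fix i
    have "\<epsilon> i -` A i \<inter> space M = {\<omega> \<in> space M. \<epsilon> i \<omega> = (if i \<in> T then 1 else - 1)}"
      by (auto simp: A_def)
    then show "prob (\<epsilon> i -` A i \<inter> space M) = 1 / 2"
      using prob_1[of i] prob_minus_1[of i] by simp
  qed simp
  also have "\<dots> = 1 / 2 ^ n" by (simp add: power_one_over)
  finally show ?thesis .
qed

lemma AE_sign: "AE \<omega> in M. \<epsilon> i \<omega> = 1 \<or> \<epsilon> i \<omega> = - 1"
proof (rule AE_I_eq_1)
  have "prob {\<omega> \<in> space M. \<epsilon> i \<omega> = 1 \<or> \<epsilon> i \<omega> = - 1} =
      prob ({\<omega> \<in> space M. \<epsilon> i \<omega> = 1} \<union> {\<omega> \<in> space M. \<epsilon> i \<omega> = - 1})"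
    by (rule arg_cong[of _ _ prob]) auto
  also have "\<dots> = 1"
    by (subst finite_measure_Union) (auto simp: prob_1 prob_minus_1)
  finally show "emeasure M {\<omega> \<in> space M. \<epsilon> i \<omega> = 1 \<or> \<epsilon> i \<omega> = - 1} = 1"
    by (simp add: emeasure_eq_measure)
qed measurable

text \<open>
  Almost surely exactly one of the \<open>2 ^ n\<close> sign patterns occurs, and independence gives each of them
  the same probability. The integrals in the definitions of type and cotype thus become finite
  averages.
\<close>

lemma expectation_norm_eq_sign_mean:
  assumes nrm: "norm_on V N" and V: "subspace V" and x: "\<And>i. i < n \<Longrightarrow> x i \<in> V"
  shows "(\<integral>\<omega>. N (\<Sum>i<n. \<epsilon> i \<omega> *\<^sub>R x i) \<partial>M) = sign_mean n (\<lambda>T. N (sign_sum n x T))"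
proof -
  define P where "P T = {\<omega> \<in> space M. \<forall>i<n. \<epsilon> i \<omega> = (if i \<in> T then 1 else - 1)}" for T
  have P_events [measurable]: "P T \<in> events" for T unfolding P_def by measurable
  have "(\<lambda>\<omega> i. \<epsilon> i \<omega>) \<in> borel_measurable M"
    by (rule measurable_coordinatewise_then_product) measurable
  then have measurable_norm: "(\<lambda>\<omega>. N (\<Sum>i<n. \<epsilon> i \<omega> *\<^sub>R x i)) \<in> borel_measurable M"
    using measurable_compose borel_measurable_continuous_onI[OF
        norm_on_linear_combination_continuous[OF nrm V x]] by fast
  have "AE \<omega> in M. \<forall>i\<in>{..<n}. \<epsilon> i \<omega> = 1 \<or> \<epsilon> i \<omega> = - 1"
    by (intro AE_finite_allI AE_sign) simp
  then have "AE \<omega> in M. N (\<Sum>i<n. \<epsilon> i \<omega> *\<^sub>R x i) =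
      (\<Sum>T\<in>Pow {..<n}. indicator (P T) \<omega> * N (sign_sum n x T))"
    using AE_space
  proof eventually_elim
    case (elim \<omega>)
    define S where "S = {i. i < n \<and> \<epsilon> i \<omega> = 1}"
    have S: "S \<in> Pow {..<n}" by (auto simp: S_def)
    have signs: "\<epsilon> i \<omega> = (if i \<in> S then 1 else - 1)" if "i < n" for i
      using elim(1) that by (auto simp: S_def)
    have "\<omega> \<in> P T \<longleftrightarrow> T = S" if "T \<subseteq> {..<n}" for T
      using that signs elim(2) by (fastforce simp: P_def S_def split: if_splits)
    then have "(\<Sum>T\<in>Pow {..<n}. indicator (P T) \<omega> * N (sign_sum n x T)) =
        (\<Sum>T\<in>Pow {..<n}. if T = S then N (sign_sum n x T) else 0)"
      by (intro sum.cong) (auto simp: indicator_def)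
    also have "\<dots> = N (sign_sum n x S)" using S by simp
    also have "sign_sum n x S = (\<Sum>i<n. \<epsilon> i \<omega> *\<^sub>R x i)"
      unfolding sign_sum_def using signs by (intro sum.cong) auto
    finally show ?case by simp
  qed
  then have "(\<integral>\<omega>. N (\<Sum>i<n. \<epsilon> i \<omega> *\<^sub>R x i) \<partial>M) =
      (\<integral>\<omega>. (\<Sum>T\<in>Pow {..<n}. indicator (P T) \<omega> * N (sign_sum n x T)) \<partial>M)"
    by (intro integral_cong_AE measurable_norm borel_measurable_sum borel_measurable_times
        borel_measurable_indicator P_events borel_measurable_const)
  also have "\<dots> = (\<Sum>T\<in>Pow {..<n}. prob (P T) * N (sign_sum n x T))"
    by (subst Bochner_Integration.integral_sum) (simp_all add: less_top[symmetric])
  also have "\<dots> = sign_mean n (\<lambda>T. N (sign_sum n x T))"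
    by (simp add: P_def prob_sign_pattern sign_mean_def sum_divide_distrib)
  finally show ?thesis .
qed

end

section \<open>Type and cotype of inclusions that factor through a Hilbert space\<close>

lemma sqrt_sum_squares_le_cmult:
  fixes f g :: "'i \<Rightarrow> real"
  assumes "0 \<le> C" "\<And>i. i \<in> I \<Longrightarrow> 0 \<le> f i" "\<And>i. i \<in> I \<Longrightarrow> f i \<le> C * g i"
  shows "sqrt (\<Sum>i\<in>I. (f i)\<^sup>2) \<le> C * sqrt (\<Sum>i\<in>I. (g i)\<^sup>2)"
proof -
  have "(\<Sum>i\<in>I. (f i)\<^sup>2) \<le> (\<Sum>i\<in>I. (C * g i)\<^sup>2)"
    using assms by (intro sum_mono power_mono) auto
  also have "\<dots> = C\<^sup>2 * (\<Sum>i\<in>I. (g i)\<^sup>2)"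
    by (simp add: power_mult_distrib sum_distrib_left)
  finally have "sqrt (\<Sum>i\<in>I. (f i)\<^sup>2) \<le> sqrt (C\<^sup>2 * (\<Sum>i\<in>I. (g i)\<^sup>2))"
    by simp
  then show ?thesis using \<open>0 \<le> C\<close> by (simp add: real_sqrt_mult)
qed

theorem corollary9:
  fixes E F :: "('x \<Rightarrow> real) set"
    and norm_E norm_F :: "('x \<Rightarrow> real) \<Rightarrow> real"
    and M :: "'w measure" and \<epsilon> :: "nat \<Rightarrow> 'w \<Rightarrow> real"
  assumes "rademacher_sequence M \<epsilon>"
    and "proper_bsf E norm_E" and "proper_bsf F norm_F"
    and "E \<subseteq> F"
    and "\<exists>H norm_H. rkhs H norm_H \<and> E \<subseteq> H \<and> H \<subseteq> F"
  shows "type_2 M \<epsilon> E norm_E F norm_F id \<and> cotype_2 M \<epsilon> E norm_E F norm_F id"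
proof -
  interpret rademacher_sequence M \<epsilon> by fact
  obtain H norm_H where H: "rkhs H norm_H" and EH: "E \<subseteq> H" and HF: "H \<subseteq> F"
    using assms(5) by blast
  have proper_H: "proper_bsf H norm_H" and hilbert: "hilbert_norm_on H norm_H"
    using H by (simp_all add: rkhs_def)
  have subE: "subspace E" and nE: "norm_on E norm_E"
    and subH: "subspace H" and nH: "norm_on H norm_H"
    and subF: "subspace F" and nF: "norm_on F norm_F"
    using assms(2,3) proper_H by (simp_all add: proper_bsf_def bsf_def banach_space_on_def)
  obtain C where "0 \<le> C" and C: "\<And>x. x \<in> E \<Longrightarrow> norm_H x \<le> C * norm_E x"
    using proper_bsf_inclusion_bounded[OF assms(2) proper_H EH] by metis
  obtain D where "0 \<le> D" and D: "\<And>x. x \<in> H \<Longrightarrow> norm_F x \<le> D * norm_H x"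
    using proper_bsf_inclusion_bounded[OF proper_H assms(3) HF] by metis
  have DC: "0 \<le> D * C" using \<open>0 \<le> C\<close> \<open>0 \<le> D\<close> by simp
  have "norm_F x \<le> D * C * norm_E x" if "x \<in> E" for x
    using D[of x] mult_left_mono[OF C[OF that] \<open>0 \<le> D\<close>] that EH by (auto simp: mult.assoc)
  then have bounded: "bounded_linear_operator_on E norm_E F norm_F id"
    unfolding bounded_linear_operator_on_def using DC assms(4) by auto
  have type: "(\<integral>\<omega>. norm_F (\<Sum>i<n. \<epsilon> i \<omega> *\<^sub>R x i) \<partial>M) \<le> D * C * sqrt (\<Sum>i<n. (norm_E (x i))\<^sup>2)"
    if x: "\<forall>i<n. x i \<in> E" for n x
  proof -
    have xH: "x i \<in> H" and xF: "x i \<in> F" if "i < n" for i using x that EH HF by auto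
    have "(\<integral>\<omega>. norm_F (\<Sum>i<n. \<epsilon> i \<omega> *\<^sub>R x i) \<partial>M) = sign_mean n (\<lambda>T. norm_F (sign_sum n x T))"
      using xF by (rule expectation_norm_eq_sign_mean[OF nF subF])
    also have "\<dots> \<le> sign_mean n (\<lambda>T. D * norm_H (sign_sum n x T))"
      by (intro sign_mean_mono D sign_sum_in_subspace[OF subH] xH)
    also have "\<dots> = D * sign_mean n (\<lambda>T. norm_H (sign_sum n x T))"
      by (rule sign_mean_cmult)
    also have "\<dots> \<le> D * sqrt (\<Sum>i<n. (norm_H (x i))\<^sup>2)"
      using Hilbert_sign_mean_bounds(1)[OF hilbert subH xH] \<open>0 \<le> D\<close> by (rule mult_left_mono)
    also have "\<dots> \<le> D * (C * sqrt (\<Sum>i<n. (norm_E (x i))\<^sup>2))"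
      using x C norm_onD(1)[OF nH xH] \<open>0 \<le> C\<close> \<open>0 \<le> D\<close>
      by (intro mult_left_mono sqrt_sum_squares_le_cmult) auto
    finally show ?thesis by (simp add: mult.assoc)
  qed
  have cotype: "sqrt (\<Sum>i<n. (norm_F (x i))\<^sup>2) \<le> 9 / 5 * (D * C) * (\<integral>\<omega>. norm_E (\<Sum>i<n. \<epsilon> i \<omega> *\<^sub>R x i) \<partial>M)"
    if x: "\<forall>i<n. x i \<in> E" for n x
  proof -
    have xE: "x i \<in> E" and xH: "x i \<in> H" and xF: "x i \<in> F" if "i < n" for i
      using x that EH HF by auto
    have "sqrt (\<Sum>i<n. (norm_F (x i))\<^sup>2) \<le> D * sqrt (\<Sum>i<n. (norm_H (x i))\<^sup>2)"
      using D xH norm_onD(1)[OF nF xF] \<open>0 \<le> D\<close> by (intro sqrt_sum_squares_le_cmult) auto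
    also have "\<dots> \<le> D * (9 / 5 * sign_mean n (\<lambda>T. norm_H (sign_sum n x T)))"
      using Hilbert_sign_mean_bounds(2)[OF hilbert subH xH, of n "\<lambda>i. i"] \<open>0 \<le> D\<close>
      by (intro mult_left_mono) auto
    also have "\<dots> \<le> D * (9 / 5 * sign_mean n (\<lambda>T. C * norm_E (sign_sum n x T)))"
      using \<open>0 \<le> D\<close> by (intro mult_left_mono sign_mean_mono C sign_sum_in_subspace[OF subE] xE) auto
    also have "\<dots> = 9 / 5 * (D * C) * (\<integral>\<omega>. norm_E (\<Sum>i<n. \<epsilon> i \<omega> *\<^sub>R x i) \<partial>M)"
      by (simp add: sign_mean_cmult expectation_norm_eq_sign_mean[OF nE subE xE])
    finally show ?thesis .
  qed
  have "type_2 M \<epsilon> E norm_E F norm_F id"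
    unfolding type_2_def
    by (intro conjI exI[of _ "D * C"] allI impI bounded DC) (simp only: id_apply type)
  moreover have "cotype_2 M \<epsilon> E norm_E F norm_F id"
  proof -
    have "0 \<le> 9 / 5 * (D * C)" using DC by simp
    then show ?thesis
      unfolding cotype_2_def
      by (intro conjI exI[of _ "9 / 5 * (D * C)"] allI impI bounded) (simp_all only: id_apply cotype)
  qed
  ultimately show ?thesis ..
qed

end
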